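(* Let $(G,\sigma)$ be a signed graph without long barbells and let $(\tau,f)$ be a non-negative $k$-flow of $(G,\sigma)$, where $k\ge 2$ is an integer. Then $(\tau,f)=\sum_{i=1}^{k-1}(\tau,f_i)$, i.e. $f=\sum_{i=1}^{k-1}f_i$, where each $(\tau,f_i)$ is a non-negative $2$-flow of $(G,\sigma)$.
   Context: A signed graph $(G,\sigma)$ is a graph $G$ with a signature $\sigma:E(G)\to\{-1,+1\}$; edges with $\sigma(e)=-1$ are negative. A circuit is balanced if it contains an even number of negative edges and unbalanced otherwise. A long barbell is the union of two vertex-disjoint unbalanced circuits together with a path meeting the circuits only at its two ends. Each edge $e=uv$ consists of half-edges $h_e^u$ and $h_e^v$; $H(v)$ is the set of half-edges at $v$. An orientation is a map $\tau$ from half-edges to $\{\pm1\}$ with $\tau(h_e^u)\tau(h_e^v)=-\sigma(e)$ for each edge $e=uv$. For $f:E(G)\to\mathbb{R}$, $(\tau,f)$ is a flow if $\sum_{h\in H(v)}\tau(h)f(e_h)=0$ for every vertex $v$ ($e_h$ the edge containing $h$). A $k$-flow is a flow with $f(e)\in\mathbb{Z}$ and $|f(e)|\le k-1$ for all $e$; it is non-negative if $f(e)\ge 0$ for all $e$. A $2$-flow thus has values in $\{-1,0,1\}$. *)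

theory Defs imports Complex_Main begin

text \<open>
  Finite signed multigraphs; loops and parallel edges are allowed.  The edge \<open>e\<close> has the two ends
  \<open>ends G e False\<close> and \<open>ends G e True\<close>, in an arbitrary order.  Its two half-edges are
  \<open>(e, False)\<close> and \<open>(e, True)\<close>, so that a loop at \<open>v\<close> has two distinct half-edges at \<open>v\<close>.
\<close>

record ('v, 'e) sgraph =
  verts :: "'v set"
  edges :: "'e set"
  ends :: "'e \<Rightarrow> bool \<Rightarrow> 'v"
  signature :: "'e \<Rightarrow> int"

definition signed_graph :: "('v, 'e) sgraph \<Rightarrow> bool" where
  "signed_graph G \<longleftrightarrow>
     finite (verts G) \<and> finite (edges G) \<and>
     (\<forall>e\<in>edges G. \<forall>b. ends G e b \<in> verts G) \<and>
     (\<forall>e\<in>edges G. signature G e \<in> {-1, 1})"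

definition joins :: "('v, 'e) sgraph \<Rightarrow> 'e \<Rightarrow> 'v \<Rightarrow> 'v \<Rightarrow> bool" where
  "joins G e u v \<longleftrightarrow> e \<in> edges G \<and> (\<exists>b. ends G e b = u \<and> ends G e (\<not> b) = v)"

text \<open>
  Circuits and paths are given by their sequences of vertices and edges.  A circuit of length 1 is
  a loop; distinctness of the edges matters for length 2, where it demands two parallel edges.
\<close>

definition circuit :: "('v, 'e) sgraph \<Rightarrow> 'v list \<Rightarrow> 'e list \<Rightarrow> bool" where
  "circuit G vs es \<longleftrightarrow>
     vs \<noteq> [] \<and> length es = length vs \<and> distinct vs \<and> distinct es \<and> set vs \<subseteq> verts G \<and>
     (\<forall>i<length vs. joins G (es ! i) (vs ! i) (vs ! (Suc i mod length vs)))"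

definition path :: "('v, 'e) sgraph \<Rightarrow> 'v list \<Rightarrow> 'e list \<Rightarrow> bool" where
  "path G vs es \<longleftrightarrow>
     length vs = Suc (length es) \<and> distinct vs \<and> set vs \<subseteq> verts G \<and>
     (\<forall>i<length es. joins G (es ! i) (vs ! i) (vs ! Suc i))"

definition balanced :: "('v, 'e) sgraph \<Rightarrow> 'e set \<Rightarrow> bool" where
  "balanced G F \<longleftrightarrow> even (card {e \<in> F. signature G e = -1})"

text \<open>The subgraph with vertex set \<open>W\<close> and edge set \<open>F\<close> is a long barbell.\<close>

definition long_barbell :: "('v, 'e) sgraph \<Rightarrow> 'v set \<Rightarrow> 'e set \<Rightarrow> bool" where
  "long_barbell G W F \<longleftrightarrow>
     (\<exists>vs es us ds ps qs.
        circuit G vs es \<and> \<not> balanced G (set es) \<and>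
        circuit G us ds \<and> \<not> balanced G (set ds) \<and>
        set vs \<inter> set us = {} \<and>
        path G ps qs \<and> set ps \<inter> set vs = {hd ps} \<and> set ps \<inter> set us = {last ps} \<and>
        W = set vs \<union> set us \<union> set ps \<and> F = set es \<union> set ds \<union> set qs)"

definition half_edges_at :: "('v, 'e) sgraph \<Rightarrow> 'v \<Rightarrow> ('e \<times> bool) set" where
  "half_edges_at G v = {(e, b). e \<in> edges G \<and> ends G e b = v}"

definition orientation :: "('v, 'e) sgraph \<Rightarrow> ('e \<times> bool \<Rightarrow> int) \<Rightarrow> bool" where
  "orientation G \<tau> \<longleftrightarrow>
     (\<forall>e\<in>edges G. (\<forall>b. \<tau> (e, b) \<in> {-1, 1}) \<and>
        \<tau> (e, False) * \<tau> (e, True) = - signature G e)"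

definition flow :: "('v, 'e) sgraph \<Rightarrow> ('e \<times> bool \<Rightarrow> int) \<Rightarrow> ('e \<Rightarrow> real) \<Rightarrow> bool" where
  "flow G \<tau> f \<longleftrightarrow>
     orientation G \<tau> \<and>
     (\<forall>v\<in>verts G. (\<Sum>h\<in>half_edges_at G v. real_of_int (\<tau> h) * f (fst h)) = 0)"

definition k_flow ::
  "('v, 'e) sgraph \<Rightarrow> nat \<Rightarrow> ('e \<times> bool \<Rightarrow> int) \<Rightarrow> ('e \<Rightarrow> real) \<Rightarrow> bool" where
  "k_flow G k \<tau> f \<longleftrightarrow>
     flow G \<tau> f \<and> (\<forall>e\<in>edges G. f e \<in> \<int> \<and> \<bar>f e\<bar> \<le> real k - 1)"

definition nonneg_k_flow ::
  "('v, 'e) sgraph \<Rightarrow> nat \<Rightarrow> ('e \<times> bool \<Rightarrow> int) \<Rightarrow> ('e \<Rightarrow> real) \<Rightarrow> bool" where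
  "nonneg_k_flow G k \<tau> f \<longleftrightarrow> k_flow G k \<tau> f \<and> (\<forall>e\<in>edges G. 0 \<le> f e)"

end

theory Submission imports Defs begin

text \<open>
  It suffices to halve: for a non-negative integer flow \<open>s\<close> we look for a flow \<open>h\<close> with values in
  \<open>{-1, 0, 1}\<close> that is odd exactly where \<open>s\<close> is, so that \<open>s\<close> is the sum of the non-negative flows
  \<open>(s + h) / 2\<close> and \<open>(s - h) / 2\<close>.  The flow \<open>h\<close> is assembled from flows on subsets of the odd edges
  of \<open>s\<close>.  These edges contain a circuit \<open>C\<close>, which carries such a flow if it is balanced.
  Otherwise, a flow has even total value on the negative edges of a component of \<open>G\<close>, so removing \<open>C\<close>
  leaves an even subgraph of the component with an odd number of negative edges, which contains
  a second unbalanced circuit.  Without long barbells the two circuits meet, and together they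
  carry a flow.
\<close>

section \<open>Boundaries of integer edge functions and their parity\<close>

locale oriented_signed_graph =
  fixes G :: "('v, 'e) sgraph" and \<tau> :: "'e \<times> bool \<Rightarrow> int"
  assumes signed_graph: "signed_graph G" and orientation: "orientation G \<tau>"
begin

text \<open>An integer version of the vertex sum in \<open>flow\<close>, so that parity and halving
  apply directly.\<close>

definition boundary :: "('e \<Rightarrow> int) \<Rightarrow> 'v \<Rightarrow> int" where
  "boundary s v = (\<Sum>h\<in>half_edges_at G v. \<tau> h * s (fst h))"

definition int_flow :: "('e \<Rightarrow> int) \<Rightarrow> bool" where
  "int_flow s \<longleftrightarrow> (\<forall>v\<in>verts G. boundary s v = 0)"

definition negative_edges :: "'e set" where
  "negative_edges = {e \<in> edges G. signature G e = -1}"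

lemma finite_verts [simp]: "finite (verts G)"
  and finite_edges [simp]: "finite (edges G)"
  using signed_graph by (auto simp: signed_graph_def)

lemma ends_in_verts: "e \<in> edges G \<Longrightarrow> ends G e b \<in> verts G"
  using signed_graph by (auto simp: signed_graph_def)

lemma signature_cases: "e \<in> edges G \<Longrightarrow> signature G e = -1 \<or> signature G e = 1"
  using signed_graph by (auto simp: signed_graph_def)

lemma orientation_cases: "e \<in> edges G \<Longrightarrow> \<tau> (e, b) = -1 \<or> \<tau> (e, b) = 1"
  using orientation by (auto simp: orientation_def)

lemma orientation_mult: "e \<in> edges G \<Longrightarrow> \<tau> (e, b) * \<tau> (e, \<not> b) = - signature G e"
  using orientation by (cases b) (auto simp: orientation_def mult.commute)

lemma finite_half_edges_at [simp]: "finite (half_edges_at G v)"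
  by (rule finite_subset[of _ "edges G \<times> UNIV"]) (auto simp: half_edges_at_def)

lemma finite_negative_edges [simp]: "finite negative_edges"
  by (simp add: negative_edges_def)

text \<open>Regroups the half-edges by edge; the two ends stay separate summands, so a loop
  contributes both of its half-edges.\<close>

lemma boundary_eq_sum_edges:
  "boundary s v = (\<Sum>e\<in>edges G. ((if ends G e False = v then \<tau> (e, False) else 0)
      + (if ends G e True = v then \<tau> (e, True) else 0)) * s e)"
proof -
  have "half_edges_at G v = {h \<in> edges G \<times> UNIV. ends G (fst h) (snd h) = v}"
    by (auto simp: half_edges_at_def)
  then have "boundary s v =
      (\<Sum>h\<in>edges G \<times> UNIV. if ends G (fst h) (snd h) = v then \<tau> h * s (fst h) else 0)"
    unfolding boundary_def by (simp add: sum.inter_filter)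
  also have "\<dots> = (\<Sum>e\<in>edges G. \<Sum>b\<in>UNIV. if ends G e b = v then \<tau> (e, b) * s e else 0)"
    by (simp add: sum.cartesian_product case_prod_beta' cong: if_cong)
  also have "\<dots> = (\<Sum>e\<in>edges G. ((if ends G e False = v then \<tau> (e, False) else 0)
      + (if ends G e True = v then \<tau> (e, True) else 0)) * s e)"
    by (intro sum.cong) (auto simp: UNIV_bool algebra_simps)
  finally show ?thesis .
qed

lemma boundary_add: "boundary (\<lambda>e. s e + t e) v = boundary s v + boundary t v"
  and boundary_diff: "boundary (\<lambda>e. s e - t e) v = boundary s v - boundary t v"
  and boundary_scale: "boundary (\<lambda>e. c * s e) v = c * boundary s v"
  by (simp_all add: boundary_def algebra_simps sum.distrib sum_subtractf sum_distrib_left)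

lemma boundary_sum: "boundary (\<lambda>e. \<Sum>i\<in>I. s i e) v = (\<Sum>i\<in>I. boundary (s i) v)"
  unfolding boundary_def sum_distrib_left by (rule sum.swap)

text \<open>The free \<open>b\<close> lets either end be named first, as suits a walk that traverses
  \<open>a\<close> in an arbitrary direction.\<close>

lemma boundary_single:
  assumes "a \<in> edges G"
  shows "boundary (\<lambda>e. if e = a then c else 0) v =
    c * ((if ends G a b = v then \<tau> (a, b) else 0)
      + (if ends G a (\<not> b) = v then \<tau> (a, \<not> b) else 0))"
proof -
  have "boundary (\<lambda>e. if e = a then c else 0) v = (\<Sum>e\<in>edges G. if e = a then
      c * ((if ends G a b = v then \<tau> (a, b) else 0)
      + (if ends G a (\<not> b) = v then \<tau> (a, \<not> b) else 0)) else 0)"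
    unfolding boundary_eq_sum_edges by (intro sum.cong) (cases b; auto simp: algebra_simps)+
  then show ?thesis using assms by simp
qed

text \<open>Modulo 2 the signs vanish, so the boundary counts the odd half-edges at
  \<open>v\<close>, and an even count cannot be one. The partner may be the other half of a
  loop.\<close>

lemma odd_half_edge_partner:
  assumes "even (boundary s v)" "(e, b) \<in> half_edges_at G v" "odd (s e)"
  shows "\<exists>e' b'. (e', b') \<in> half_edges_at G v \<and> (e', b') \<noteq> (e, b) \<and> odd (s e')"
proof (rule ccontr)
  assume none: "\<not> ?thesis"
  have unique: "h = (e, b)" if "h \<in> half_edges_at G v" "odd (s (fst h))" for h
  proof (rule ccontr)
    assume "h \<noteq> (e, b)"
    moreover obtain e' b' where "h = (e', b')" by (rule prod.exhaust)
    ultimately show False using none that by (metis fst_conv)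
  qed
  have odd_iff: "odd (\<tau> h * s (fst h)) \<longleftrightarrow> odd (s (fst h))" if "h \<in> half_edges_at G v" for h
    using that orientation_cases[of "fst h" "snd h"] by (auto simp: half_edges_at_def)
  have "{h \<in> half_edges_at G v. odd (\<tau> h * s (fst h))} = {(e, b)}"
  proof (intro equalityI subsetI)
    fix h assume "h \<in> {h \<in> half_edges_at G v. odd (\<tau> h * s (fst h))}"
    then have "h = (e, b)" using unique odd_iff by blast
    then show "h \<in> {(e, b)}" by blast
  next
    fix h assume "h \<in> {(e, b)}"
    then show "h \<in> {h \<in> half_edges_at G v. odd (\<tau> h * s (fst h))}"
      using odd_iff[OF assms(2)] assms(2,3) by simp
  qed
  then show False
    using assms(1) by (simp add: boundary_def even_sum_iff)
qed

text \<open>Sum the boundaries over all vertices: the two half-edges cancel on a positive edge and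
  agree on a negative one, so a signed sum of \<open>s\<close> over the negative edges is 0. The
  signs do not affect its parity.\<close>

lemma int_flow_even_negative:
  assumes "int_flow s"
  shows "even (\<Sum>e\<in>negative_edges. s e)"
proof -
  have "0 = (\<Sum>v\<in>verts G. boundary s v)"
    using assms by (simp add: int_flow_def)
  also have "\<dots> = (\<Sum>e\<in>edges G. \<Sum>v\<in>verts G. ((if ends G e False = v then \<tau> (e, False) else 0)
      + (if ends G e True = v then \<tau> (e, True) else 0)) * s e)"
    unfolding boundary_eq_sum_edges by (rule sum.swap)
  also have "\<dots> = (\<Sum>e\<in>edges G. (\<tau> (e, False) + \<tau> (e, True)) * s e)"
    by (intro sum.cong) (simp_all add: sum.distrib ends_in_verts flip: sum_distrib_right)
  also have "\<dots> = (\<Sum>e\<in>edges G. if signature G e = -1 then 2 * (\<tau> (e, False) * s e) else 0)"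
  proof (intro sum.cong refl)
    fix e assume e: "e \<in> edges G"
    show "(\<tau> (e, False) + \<tau> (e, True)) * s e =
        (if signature G e = -1 then 2 * (\<tau> (e, False) * s e) else 0)"
      using orientation_mult[OF e, of False] orientation_cases[OF e, of False]
        orientation_cases[OF e, of True] signature_cases[OF e] by auto
  qed
  also have "\<dots> = 2 * (\<Sum>e\<in>negative_edges. \<tau> (e, False) * s e)"
    by (simp add: negative_edges_def sum.inter_filter sum_distrib_left if_distrib cong: if_cong)
  finally have "(\<Sum>e\<in>negative_edges. \<tau> (e, False) * s e) = 0" by simp
  then have "even (\<Sum>e\<in>negative_edges. \<tau> (e, False) * s e)" by simp
  moreover have "odd (\<tau> (e, False))" if "e \<in> negative_edges" for e
    using that orientation_cases[of e False] by (auto simp: negative_edges_def)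
  then have "{e \<in> negative_edges. odd (\<tau> (e, False) * s e)} = {e \<in> negative_edges. odd (s e)}"
    by auto
  ultimately show ?thesis by (simp add: even_sum_iff)
qed

section \<open>Circuits and the flows they carry\<close>

lemma circuit_edges: "circuit G vs es \<Longrightarrow> set es \<subseteq> edges G"
  by (fastforce simp: circuit_def joins_def in_set_conv_nth)

lemma prod_signature:
  assumes "F \<subseteq> edges G"
  shows "(\<Prod>e\<in>F. signature G e) = (if balanced G F then 1 else -1)"
proof -
  have fin: "finite F" using assms finite_edges finite_subset by blast
  have "(\<Prod>e\<in>F. signature G e) = (\<Prod>e\<in>F. if signature G e = -1 then -1 else 1)"
    using assms signature_cases by (intro prod.cong) auto
  also have "\<dots> = (\<Prod>e\<in>{e\<in>F. signature G e = -1}. -1)"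
    using fin by (rule prod.inter_filter[symmetric])
  also have "\<dots> = (if balanced G F then 1 else -1)"
    by (simp add: balanced_def)
  finally show ?thesis .
qed

text \<open>Walking along the circuit, the sign of the flow is propagated so that it cancels at every
  vertex but the first one, where it returns multiplied by the product of the signatures.\<close>

lemma circuit_int_flow:
  assumes circ: "circuit G vs es"
  obtains h where "\<And>e. e \<in> set es \<Longrightarrow> h e = -1 \<or> h e = 1" "\<And>e. e \<notin> set es \<Longrightarrow> h e = 0"
    "\<And>v. boundary h v = (if v = hd vs \<and> \<not> balanced G (set es) then 2 else 0)"
proof -
  define n where "n = length vs"
  have n: "n > 0" "length es = n" and dist: "distinct es"
    and joins: "\<And>i. i < n \<Longrightarrow> joins G (es ! i) (vs ! i) (vs ! (Suc i mod n))"
    using circ by (auto simp: circuit_def n_def)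
  have "\<forall>i. \<exists>b. i < n \<longrightarrow> es ! i \<in> edges G \<and> ends G (es ! i) b = vs ! i
      \<and> ends G (es ! i) (\<not> b) = vs ! (Suc i mod n)"
    using joins by (auto simp: joins_def)
  \<comment> \<open>\<open>b i\<close> marks the half-edge of \<open>es ! i\<close> by which the
    walk leaves \<open>vs ! i\<close>.\<close>
  then obtain b where b: "\<And>i. i < n \<Longrightarrow> es ! i \<in> edges G \<and> ends G (es ! i) (b i) = vs ! i
      \<and> ends G (es ! i) (\<not> b i) = vs ! (Suc i mod n)"
    by metis
  \<comment> \<open>The sign accumulated before the \<open>i\<close>-th edge; multiplying by the
    signature makes arrival and departure cancel at the next vertex.\<close>
  define p where "p i = (\<Prod>j<i. signature G (es ! j))" for i
  have p: "p i = -1 \<or> p i = 1" if "i \<le> n" for i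
    using that
  proof (induction i)
    case (Suc i)
    then show ?case using b[of i] signature_cases[of "es ! i"] by (auto simp: p_def)
  qed (simp add: p_def)
  \<comment> \<open>A sum of single-edge functions, so that \<open>boundary_single\<close> applies;
    as \<open>es\<close> is distinct, at most one summand is nonzero.\<close>
  define h where "h e = (\<Sum>i<n. if e = es ! i then \<tau> (es ! i, b i) * p i else 0)" for e
  have h_nth: "h (es ! i) = \<tau> (es ! i, b i) * p i" if "i < n" for i
  proof -
    have "h (es ! i) = (\<Sum>j<n. if j = i then \<tau> (es ! i, b i) * p i else 0)"
      unfolding h_def using that dist n by (intro sum.cong) (auto simp: nth_eq_iff_index_eq)
    then show ?thesis using that by simp
  qed
  show thesis
  proof
    fix e
    assume "e \<in> set es"
    then obtain i where "i < n" "e = es ! i" using n by (auto simp: in_set_conv_nth)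
    then show "h e = -1 \<or> h e = 1"
      using h_nth p[of i] b[of i] orientation_cases[of e "b i"] by auto
  next
    fix e
    assume "e \<notin> set es"
    then have "e \<noteq> es ! i" if "i < n" for i using n that by auto
    then show "h e = 0" by (simp add: h_def)
  next
    fix v
    \<comment> \<open>The vertex index is reduced modulo \<open>n\<close> but the index of
      \<open>p\<close> is not: \<open>w n\<close> is the return to the first vertex with sign
      \<open>p n\<close>, where \<open>w 0\<close> has sign 1.\<close>
    define w where "w i = (if vs ! (i mod n) = v then p i else 0)" for i
    have "boundary h v = (\<Sum>i<n. boundary (\<lambda>e. if e = es ! i then \<tau> (es ! i, b i) * p i else 0) v)"
      unfolding h_def by (rule boundary_sum)
    also have "\<dots> = (\<Sum>i<n. w i - w (Suc i))"
    proof (intro sum.cong refl)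
      fix i assume "i \<in> {..<n}"
      then have i: "i < n" by simp
      have "\<tau> (es ! i, b i) * \<tau> (es ! i, b i) = 1"
        using orientation_cases[of "es ! i" "b i"] b[OF i] by auto
      moreover have "\<tau> (es ! i, b i) * \<tau> (es ! i, \<not> b i) = - signature G (es ! i)"
        using orientation_mult b[OF i] by auto
      moreover have "p (Suc i) = p i * signature G (es ! i)"
        by (simp add: p_def)
      ultimately show "boundary (\<lambda>e. if e = es ! i then \<tau> (es ! i, b i) * p i else 0) v
          = w i - w (Suc i)"
        using b[OF i] i boundary_single[of "es ! i" "\<tau> (es ! i, b i) * p i" v "b i"]
        by (auto simp: w_def algebra_simps)
    qed
    also have "\<dots> = w 0 - w n" by (rule sum_lessThan_telescope')
    also have "\<dots> = (if v = hd vs then 1 - p n else 0)"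
      using n by (auto simp: w_def p_def hd_conv_nth n_def)
    also have "p n = (\<Prod>e\<in>set es. signature G e)"
    proof -
      have "bij_betw ((!) es) {..<n} (set es)"
        using dist n by (simp add: bij_betw_nth)
      then show ?thesis unfolding p_def by (rule prod.reindex_bij_betw)
    qed
    also have "\<dots> = (if balanced G (set es) then 1 else -1)"
      by (rule prod_signature) (rule circuit_edges[OF circ])
    finally show "boundary h v = (if v = hd vs \<and> \<not> balanced G (set es) then 2 else 0)"
      by simp
  qed
qed

section \<open>Circuits among the odd edges\<close>

text \<open>Walk along odd edges without turning straight back, which
  \<open>odd_half_edge_partner\<close> makes possible. The first return to a visited vertex closes a
  circuit.\<close>

lemma exists_circuit:
  assumes even: "\<And>v. v \<in> verts G \<Longrightarrow> even (boundary s v)"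
    and e: "e \<in> edges G" "odd (s e)"
  shows "\<exists>vs es. circuit G vs es \<and> (\<forall>e\<in>set es. odd (s e))"
proof -
  \<comment> \<open>A half-edge \<open>h\<close> stands for the step that leaves its own end along
    \<open>fst h\<close>; the step arrives by \<open>(fst h, \<not> snd h)\<close>.\<close>
  define P where "P h \<longleftrightarrow> fst h \<in> edges G \<and> odd (s (fst h))" for h :: "'e \<times> bool"
  have "\<exists>h'. P h \<longrightarrow> P h' \<and> ends G (fst h') (snd h') = ends G (fst h) (\<not> snd h)
      \<and> h' \<noteq> (fst h, \<not> snd h)" for h
  proof (cases "P h")
    case True
    then show ?thesis
      using odd_half_edge_partner[OF even, of "ends G (fst h) (\<not> snd h)" "fst h" "\<not> snd h"]
        ends_in_verts[of "fst h" "\<not> snd h"]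
      by (fastforce simp: P_def half_edges_at_def)
  qed auto
  then obtain nxt where nxt: "\<And>h. P h \<Longrightarrow> P (nxt h) \<and>
      ends G (fst (nxt h)) (snd (nxt h)) = ends G (fst h) (\<not> snd h) \<and> nxt h \<noteq> (fst h, \<not> snd h)"
    by metis
  define H where "H i = (nxt ^^ i) (e, False)" for i
  define v where "v i = ends G (fst (H i)) (snd (H i))" for i
  have P: "P (H i)" for i
    by (induction i) (use e nxt in \<open>auto simp: H_def P_def\<close>)
  have v_Suc: "v (Suc i) = ends G (fst (H i)) (\<not> snd (H i))"
    and H_Suc: "H (Suc i) \<noteq> (fst (H i), \<not> snd (H i))" for i
    using nxt[OF P[of i]] by (auto simp: v_def H_def)
  have v_verts: "v i \<in> verts G" for i
    using P[of i] by (simp add: v_def P_def ends_in_verts)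
  have "\<not> inj v"
    using finite_subset[of "range v" "verts G"] v_verts finite_imageD by fastforce
  then have "\<exists>j. \<exists>i<j. v i = v j"
    by (metis injI linorder_neqE_nat)
  \<comment> \<open>By minimality the vertices before \<open>j\<close> are distinct, so the segment
    from \<open>i\<close> to \<open>j\<close> has no inner repetition.\<close>
  define j where "j = (LEAST j. \<exists>i<j. v i = v j)"
  obtain i where i: "i < j" "v i = v j"
    using LeastI_ex[OF \<open>\<exists>j. \<exists>i<j. v i = v j\<close>] by (auto simp: j_def)
  have inj: "a = b" if "v a = v b" "a < j" "b < j" for a b
    using that not_less_Least[of a "\<lambda>j. \<exists>i<j. v i = v j"]
      not_less_Least[of b "\<lambda>j. \<exists>i<j. v i = v j"] unfolding j_def[symmetric]
    by (metis linorder_neqE_nat)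
  \<comment> \<open>An edge used twice in the same direction repeats a vertex. Used in opposite
    directions, it forces \<open>b = Suc a\<close>, an immediate turn back.\<close>
  have edge_less: "fst (H a) \<noteq> fst (H b)" if "a < b" "b < j" for a b
  proof
    assume eq: "fst (H a) = fst (H b)"
    show False
    proof (cases "snd (H a) = snd (H b)")
      case True
      then have "v a = v b" using eq by (simp add: v_def)
      then show False using inj[of a b] that by simp
    next
      case False
      then have "H b = (fst (H a), \<not> snd (H a))" using eq by (simp add: prod_eq_iff)
      moreover from this have "v (Suc a) = v b" by (simp add: v_Suc v_def[of b])
      then have "b = Suc a" using inj[of "Suc a" b] that by simp
      ultimately show False using H_Suc by metis
    qed
  qed
  then have inj_edge: "a = b" if "fst (H a) = fst (H b)" "a < j" "b < j" for a b
    using that by (metis linorder_neqE_nat)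
  have "circuit G (map v [i..<j]) (map (fst \<circ> H) [i..<j])"
    unfolding circuit_def
  proof (intro conjI allI impI)
    show "distinct (map v [i..<j])" "distinct (map (fst \<circ> H) [i..<j])"
      using inj inj_edge by (auto simp: distinct_map inj_on_def)
  next
    fix k assume "k < length (map v [i..<j])"
    then have k: "i + k < j" by simp
    have "map v [i..<j] ! (Suc k mod length (map v [i..<j])) = v (Suc (i + k))"
    proof (cases "Suc (i + k) = j")
      case True
      then have "length (map v [i..<j]) = Suc k" by auto
      then show ?thesis using True i by simp
    next
      case False
      then show ?thesis using k by simp
    qed
    then show "joins G (map (fst \<circ> H) [i..<j] ! k) (map v [i..<j] ! k)
        (map v [i..<j] ! (Suc k mod length (map v [i..<j])))"
      using P[of "i + k"] k v_Suc[of "i + k"] by (auto simp: joins_def P_def v_def)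
  qed (use i v_verts in auto)
  moreover have "\<forall>e\<in>set (map (fst \<circ> H) [i..<j]). odd (s e)"
    using P by (auto simp: P_def)
  ultimately show ?thesis by blast
qed

lemma even_negative_circuit_flow:
  assumes "circuit G vs es" "\<And>e. odd (h e) \<longleftrightarrow> e \<in> set es"
  shows "even (\<Sum>e\<in>negative_edges. h e) \<longleftrightarrow> balanced G (set es)"
proof -
  have "{e \<in> negative_edges. odd (h e)} = {e \<in> set es. signature G e = -1}"
    using assms circuit_edges by (auto simp: negative_edges_def)
  then show ?thesis by (simp add: even_sum_iff balanced_def)
qed

text \<open>Induction on the number of odd edges: subtracting the flow of a balanced circuit makes
  its edges even and preserves both the boundary and the odd parity of the negative total, so an
  unbalanced circuit must eventually appear.\<close>

lemma exists_unbalanced_circuit: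
  assumes "\<And>v. v \<in> verts G \<Longrightarrow> even (boundary s v)" "odd (\<Sum>e\<in>negative_edges. s e)"
  shows "\<exists>vs es. circuit G vs es \<and> \<not> balanced G (set es) \<and> (\<forall>e\<in>set es. odd (s e))"
  using assms
proof (induction "card {e \<in> edges G. odd (s e)}" arbitrary: s rule: less_induct)
  case less
  obtain e where "e \<in> edges G" "odd (s e)"
    using less.prems(2) by (metis (mono_tags, lifting) dvd_sum mem_Collect_eq negative_edges_def)
  then obtain vs es where C: "circuit G vs es" "\<forall>e\<in>set es. odd (s e)"
    using exists_circuit less.prems(1) by blast
  show ?case
  proof (cases "balanced G (set es)")
    case True
    obtain h where h: "\<And>e. e \<in> set es \<Longrightarrow> h e = -1 \<or> h e = 1" "\<And>e. e \<notin> set es \<Longrightarrow> h e = 0"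
      "\<And>v. boundary h v = (if v = hd vs \<and> \<not> balanced G (set es) then 2 else 0)"
      by (rule circuit_int_flow[OF C(1)]) blast
    have h_odd: "odd (h e) \<longleftrightarrow> e \<in> set es" for e
      using h(1,2)[of e] by (cases "e \<in> set es") auto
    have "es ! 0 \<in> set es" using C(1) by (auto simp: circuit_def)
    then have "{e \<in> edges G. odd (s e - h e)} \<subset> {e \<in> edges G. odd (s e)}"
      using C circuit_edges h_odd by fastforce
    then have "card {e \<in> edges G. odd (s e - h e)} < card {e \<in> edges G. odd (s e)}"
      by (intro psubset_card_mono) auto
    moreover have "even (boundary (\<lambda>e. s e - h e) v)" if "v \<in> verts G" for v
      using less.prems(1)[OF that] h(3) by (simp add: boundary_diff)
    moreover have "odd (\<Sum>e\<in>negative_edges. s e - h e)"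
      using less.prems(2) even_negative_circuit_flow[OF C(1) h_odd] True by (simp add: sum_subtractf)
    ultimately obtain us ds where D: "circuit G us ds" "\<not> balanced G (set ds)"
        "\<forall>e\<in>set ds. odd (s e - h e)"
      using less.hyps[of "\<lambda>e. s e - h e"] by blast
    have "odd (s e)" if "e \<in> set ds" for e
      using D(3) that C(2) h_odd by auto
    then show ?thesis using D by blast
  qed (use C in blast)
qed

section \<open>Rotated circuits, paths and components\<close>

lemma circuit_rotate:
  assumes "circuit G vs es"
  shows "circuit G (rotate m vs) (rotate m es)"
  unfolding circuit_def
proof (intro conjI allI impI)
  fix i assume i: "i < length (rotate m vs)"
  define n where "n = length vs"
  have n: "length es = n" "n > 0" "i < n"
    and joins: "\<And>i. i < n \<Longrightarrow> joins G (es ! i) (vs ! i) (vs ! (Suc i mod n))"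
    using assms i by (auto simp: circuit_def n_def)
  have "rotate m vs ! (Suc i mod n) = vs ! (Suc ((m + i) mod n) mod n)"
    using n by (simp add: nth_rotate n_def[symmetric] mod_simps)
  then show "joins G (rotate m es ! i) (rotate m vs ! i)
      (rotate m vs ! (Suc i mod length (rotate m vs)))"
    using joins[of "(m + i) mod n"] n by (simp add: nth_rotate n_def[symmetric])
qed (use assms in \<open>auto simp: circuit_def\<close>)

text \<open>\<open>circuit_int_flow\<close> leaves its surplus at the first vertex; rotation moves
  that surplus to a vertex shared with another circuit.\<close>

lemma circuit_start_at:
  assumes "circuit G vs es" "v \<in> set vs"
  obtains vs' es' where "circuit G vs' es'" "set es' = set es" "hd vs' = v"
proof -
  obtain m where "m < length vs" "vs ! m = v"
    using assms(2) by (auto simp: in_set_conv_nth)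
  then have "hd (rotate m vs) = v"
    by (metis hd_rotate_conv_nth list.size(3) mod_less not_less_zero)
  then show thesis using that circuit_rotate[OF assms(1)] by (metis set_rotate)
qed

text \<open>If \<open>w\<close> already lies on the path, the path is cut there instead of
  prolonged, which keeps its vertices distinct.\<close>

lemma path_extend:
  assumes "path G ps qs" "joins G e (last ps) w"
  shows "\<exists>ps' qs'. path G ps' qs' \<and> hd ps' = hd ps \<and> last ps' = w"
proof (cases "w \<in> set ps")
  case True
  then obtain i where i: "i < length ps" "ps ! i = w" by (auto simp: in_set_conv_nth)
  have "path G (take (Suc i) ps) (take i qs)"
    using assms(1) i by (auto simp: path_def dest: in_set_takeD)
  moreover have "hd (take (Suc i) ps) = hd ps" "last (take (Suc i) ps) = w"
    using i by (auto simp: take_Suc_conv_app_nth hd_append hd_conv_nth)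
  ultimately show ?thesis by blast
next
  case False
  have "path G (ps @ [w]) (qs @ [e])"
    unfolding path_def
  proof (intro conjI allI impI)
    fix i assume "i < length (qs @ [e])"
    then consider "i < length qs" | "i = length qs" by fastforce
    then show "joins G ((qs @ [e]) ! i) ((ps @ [w]) ! i) ((ps @ [w]) ! Suc i)"
    proof cases
      case 1
      then show ?thesis using assms(1) by (auto simp: path_def nth_append)
    next
      case 2
      have "ps \<noteq> []" "length ps = Suc i" using assms(1) 2 by (auto simp: path_def)
      then show ?thesis using assms(2) 2 by (simp add: nth_append last_conv_nth)
    qed
  qed (use assms False in \<open>auto simp: path_def joins_def ends_in_verts\<close>)
  moreover have "ps \<noteq> []" using assms(1) by (auto simp: path_def)
  ultimately show ?thesis by (metis hd_append2 last_snoc)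
qed

text \<open>Symmetric because \<open>joins\<close> is, so the classes of its reflexive transitive
  closure on the vertices are the components.\<close>

definition adjacency :: "('v \<times> 'v) set" where
  "adjacency = {(u, v). \<exists>e. joins G e u v}"

lemma path_of_rtrancl:
  assumes "(u, w) \<in> adjacency\<^sup>*" "u \<in> verts G"
  shows "\<exists>ps qs. path G ps qs \<and> hd ps = u \<and> last ps = w"
  using assms
proof (induction rule: rtrancl_induct)
  case base
  then have "path G [u] []" by (simp add: path_def)
  then show ?case by fastforce
next
  case (step y z)
  obtain ps qs where "path G ps qs" "hd ps = u" "last ps = y"
    using step.IH step.prems by blast
  moreover obtain e where "joins G e y z" using step.hyps(2) by (auto simp: adjacency_def)
  ultimately show ?case using path_extend by blast
qed

text \<open>A path between the two circuits of minimal length meets them only at its ends.\<close>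

lemma long_barbell_of_disjoint:
  assumes C: "circuit G vs es" "\<not> balanced G (set es)"
    and D: "circuit G us ds" "\<not> balanced G (set ds)"
    and disj: "set vs \<inter> set us = {}"
    and conn: "u \<in> set vs" "w \<in> set us" "(u, w) \<in> adjacency\<^sup>*"
  shows "\<exists>W F. long_barbell G W F"
proof -
  define Q where "Q n \<longleftrightarrow> (\<exists>ps qs. path G ps qs \<and> hd ps \<in> set vs \<and> last ps \<in> set us \<and> length qs = n)"
    for n
  have "u \<in> verts G" using C(1) conn(1) by (auto simp: circuit_def)
  then have "\<exists>n. Q n" using path_of_rtrancl[OF conn(3)] conn(1,2) unfolding Q_def by metis
  then obtain n where n: "Q n" "\<And>m. Q m \<Longrightarrow> n \<le> m"
    using LeastI_ex Least_le by metis
  obtain ps qs where p: "path G ps qs" "hd ps \<in> set vs" "last ps \<in> set us" "length qs = n"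
    using n(1) by (auto simp: Q_def)
  have len: "length ps = Suc n" using p by (simp add: path_def)
  then have "ps \<noteq> []" by auto
  then have ends: "hd ps = ps ! 0" "last ps = ps ! n"
    using len by (simp_all add: hd_conv_nth last_conv_nth)
  \<comment> \<open>Starting the path at \<open>ps ! i\<close> instead would shorten it unless
    \<open>i = 0\<close>; the other end is treated likewise.\<close>
  have first: "i = 0" if "i \<le> n" "ps ! i \<in> set vs" for i
  proof -
    have "path G (drop i ps) (drop i qs)"
      using p(1) that len by (auto simp: path_def dest: in_set_dropD)
    moreover have "hd (drop i ps) = ps ! i" "last (drop i ps) = last ps"
      using len that by (simp_all add: hd_drop_conv_nth)
    moreover have "length (drop i qs) = n - i" using p(4) by simp
    ultimately have "Q (n - i)" using p(3) that(2) unfolding Q_def by metis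
    then show ?thesis using n(2)[of "n - i"] that by simp
  qed
  have last: "i = n" if "i \<le> n" "ps ! i \<in> set us" for i
  proof -
    have "path G (take (Suc i) ps) (take i qs)"
      using p(1) that len by (auto simp: path_def dest: in_set_takeD)
    moreover have "hd (take (Suc i) ps) = hd ps" "last (take (Suc i) ps) = ps ! i"
      using len that \<open>ps \<noteq> []\<close> by (auto simp: take_Suc_conv_app_nth hd_append ends)
    moreover have "length (take i qs) = i" using p(4) that(1) by simp
    ultimately have "Q i" using p(2) that(2) unfolding Q_def by metis
    then show ?thesis using n(2)[of i] that by simp
  qed
  have "set ps \<inter> set vs = {hd ps}" "set ps \<inter> set us = {last ps}"
  proof -
    have idx: "\<exists>i\<le>n. x = ps ! i" if "x \<in> set ps" for x
      using that len by (metis in_set_conv_nth less_Suc_eq_le)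
    have "x = hd ps" if "x \<in> set ps" "x \<in> set vs" for x
      using idx[OF that(1)] first that(2) ends by auto
    then show "set ps \<inter> set vs = {hd ps}" using p(2) \<open>ps \<noteq> []\<close> by auto
    have "x = last ps" if "x \<in> set ps" "x \<in> set us" for x
      using idx[OF that(1)] last that(2) ends by auto
    then show "set ps \<inter> set us = {last ps}" using p(3) \<open>ps \<noteq> []\<close> by auto
  qed
  then show ?thesis
    unfolding long_barbell_def using C D disj p(1) by blast
qed

lemma adjacency_edge: "e \<in> edges G \<Longrightarrow> (ends G e b, ends G e (\<not> b)) \<in> adjacency"
  by (auto simp: adjacency_def joins_def)

text \<open>Membership of an edge in a component can be tested at either end; below, the end
  \<open>False\<close> is used.\<close>

lemma component_edge:
  assumes "e \<in> edges G"
  shows "(u, ends G e b) \<in> adjacency\<^sup>* \<longleftrightarrow> (u, ends G e b') \<in> adjacency\<^sup>*"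
  using adjacency_edge[OF assms, of b] adjacency_edge[OF assms, of "\<not> b"]
  by (cases "b = b'") (auto intro: rtrancl_into_rtrancl)

lemma circuit_component:
  assumes "circuit G vs es" "v \<in> set vs"
  shows "(hd vs, v) \<in> adjacency\<^sup>*"
proof -
  have "(hd vs, vs ! i) \<in> adjacency\<^sup>*" if "i < length vs" for i
    using that
  proof (induction i)
    case 0
    then show ?case by (simp add: hd_conv_nth)
  next
    case (Suc i)
    have "joins G (es ! i) (vs ! i) (vs ! (Suc i mod length vs))"
      using assms(1) Suc.prems unfolding circuit_def by (meson Suc_lessD)
    then have "(vs ! i, vs ! Suc i) \<in> adjacency"
      using Suc.prems by (auto simp: adjacency_def)
    then show ?case using Suc by (auto intro: rtrancl_into_rtrancl)
  qed
  then show ?thesis using assms(2) by (auto simp: in_set_conv_nth)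
qed

lemma circuit_edge_end:
  assumes "circuit G vs es" "e \<in> set es"
  shows "\<exists>b. ends G e b \<in> set vs"
proof -
  obtain i where i: "i < length vs" "e = es ! i"
    using assms by (auto simp: in_set_conv_nth circuit_def)
  then have "joins G e (vs ! i) (vs ! (Suc i mod length vs))"
    using assms(1) by (auto simp: circuit_def)
  then show ?thesis using i(1) unfolding joins_def by (metis nth_mem)
qed

lemma circuit_first_edge:
  assumes "circuit G vs es"
  obtains e b where "e \<in> set es" "e \<in> edges G" "ends G e b = hd vs"
proof -
  have "vs \<noteq> []" "length es = length vs" "joins G (es ! 0) (vs ! 0) (vs ! (Suc 0 mod length vs))"
    using assms by (auto simp: circuit_def)
  then show thesis using that[of "es ! 0"] by (auto simp: joins_def hd_conv_nth)
qed

text \<open>All edges at \<open>v\<close> lie in the component of \<open>v\<close>, so cutting a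
  flow down to one component leaves a flow.\<close>

lemma boundary_component:
  "boundary (\<lambda>e. if (u, ends G e False) \<in> adjacency\<^sup>* then s e else 0) v =
    (if (u, v) \<in> adjacency\<^sup>* then boundary s v else 0)"
proof -
  have "boundary (\<lambda>e. if (u, ends G e False) \<in> adjacency\<^sup>* then s e else 0) v =
      (\<Sum>h\<in>half_edges_at G v. if (u, v) \<in> adjacency\<^sup>* then \<tau> h * s (fst h) else 0)"
    unfolding boundary_def
  proof (intro sum.cong refl)
    fix h assume "h \<in> half_edges_at G v"
    then have "(u, ends G (fst h) False) \<in> adjacency\<^sup>* \<longleftrightarrow> (u, v) \<in> adjacency\<^sup>*"
      using component_edge[of "fst h" u False "snd h"] by (auto simp: half_edges_at_def)
    then show "\<tau> h * (if (u, ends G (fst h) False) \<in> adjacency\<^sup>* then s (fst h) else 0) =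
        (if (u, v) \<in> adjacency\<^sup>* then \<tau> h * s (fst h) else 0)" by simp
  qed
  then show ?thesis by (simp add: boundary_def)
qed

section \<open>Flows of prescribed parity\<close>

text \<open>The induction step for \<open>exists_parity_flow\<close>: adding \<open>h\<close> to
  \<open>s\<close> creates no odd edge and makes at least one odd edge even.\<close>

lemma exists_elementary_flow:
  assumes no_barbell: "\<nexists>W F. long_barbell G W F"
    and s: "int_flow s" "e \<in> edges G" "odd (s e)"
  shows "\<exists>h. int_flow h \<and> (\<forall>e. \<bar>h e\<bar> \<le> 1) \<and> (\<forall>e. odd (h e) \<longrightarrow> odd (s e)) \<and> (\<exists>e\<in>edges G. odd (h e))"
proof -
  obtain vs es where C: "circuit G vs es" "\<forall>e\<in>set es. odd (s e)"
    using exists_circuit[of s e] s by (auto simp: int_flow_def)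
  obtain a b where a: "a \<in> set es" "a \<in> edges G" "ends G a b = hd vs"
    using circuit_first_edge[OF C(1)] .
  obtain h where h: "\<And>e. e \<in> set es \<Longrightarrow> h e = -1 \<or> h e = 1" "\<And>e. e \<notin> set es \<Longrightarrow> h e = 0"
    "\<And>v. boundary h v = (if v = hd vs \<and> \<not> balanced G (set es) then 2 else 0)"
    by (rule circuit_int_flow[OF C(1)]) blast
  have h_odd: "odd (h e) \<longleftrightarrow> e \<in> set es" for e
    using h(1,2)[of e] by (cases "e \<in> set es") auto
  show ?thesis
  proof (cases "balanced G (set es)")
    case True
    then have "int_flow h" using h(3) by (simp add: int_flow_def)
    moreover have "\<bar>h e\<bar> \<le> 1" for e using h(1,2)[of e] by (cases "e \<in> set es") auto
    ultimately show ?thesis using h_odd C(2) a by blast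
  next
    case unbal: False
    \<comment> \<open>Restricting to the component of the first circuit ensures that the second
      circuit found is connected to it.\<close>
    define t where "t e = (if (hd vs, ends G e False) \<in> adjacency\<^sup>* then s e else 0)" for e
    have t: "int_flow t"
      using s(1) boundary_component[of "hd vs" s] by (simp add: int_flow_def t_def[abs_def])
    have t_C: "t e = s e" if e: "e \<in> set es" for e
    proof -
      obtain b where "ends G e b \<in> set vs" using circuit_edge_end[OF C(1) e] by blast
      then have "(hd vs, ends G e False) \<in> adjacency\<^sup>*"
        using circuit_component[OF C(1)] component_edge circuit_edges[OF C(1)] e by blast
      then show ?thesis by (simp add: t_def)
    qed
    have "even (boundary (\<lambda>e. t e - h e) v)" if "v \<in> verts G" for v
      using t h(3) that by (simp add: boundary_diff int_flow_def)
    moreover have "odd (\<Sum>e\<in>negative_edges. t e - h e)"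
      using int_flow_even_negative[OF t] even_negative_circuit_flow[OF C(1) h_odd] unbal
      by (simp add: sum_subtractf)
    ultimately obtain us ds where D: "circuit G us ds" "\<not> balanced G (set ds)"
        "\<forall>e\<in>set ds. odd (t e - h e)"
      using exists_unbalanced_circuit[of "\<lambda>e. t e - h e"] by blast
    \<comment> \<open>On the first circuit both \<open>t\<close> and \<open>h\<close> are odd, so
      \<open>t - h\<close> is even there and the two circuits share no edge.\<close>
    have D_C: "e \<notin> set es" "odd (t e)" if "e \<in> set ds" for e
      using D(3) that h_odd[of e] t_C[of e] C(2) by auto
    have D_odd: "odd (s e)" if "e \<in> set ds" for e
      using D_C(2)[OF that] by (auto simp: t_def split: if_splits)
    obtain d c where d: "d \<in> set ds" "d \<in> edges G" "ends G d c = hd us"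
      using circuit_first_edge[OF D(1)] .
    have "(hd vs, ends G d False) \<in> adjacency\<^sup>*"
      using D_C(2)[OF d(1)] by (auto simp: t_def split: if_splits)
    then have "(hd vs, hd us) \<in> adjacency\<^sup>*"
      using component_edge[OF d(2)] d(3) by metis
    moreover have "hd vs \<in> set vs" "hd us \<in> set us"
      using C(1) D(1) by (auto simp: circuit_def)
    ultimately have "set vs \<inter> set us \<noteq> {}"
      using long_barbell_of_disjoint[OF C(1) unbal D(1,2)] no_barbell by blast
    then obtain v where v: "v \<in> set vs" "v \<in> set us" by blast
    obtain vs' es' where C': "circuit G vs' es'" "set es' = set es" "hd vs' = v"
      using circuit_start_at[OF C(1) v(1)] .
    obtain us' ds' where D': "circuit G us' ds'" "set ds' = set ds" "hd us' = v"
      using circuit_start_at[OF D(1) v(2)] .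
    obtain p where p: "\<And>e. e \<in> set es \<Longrightarrow> p e = -1 \<or> p e = 1" "\<And>e. e \<notin> set es \<Longrightarrow> p e = 0"
      "\<And>w. boundary p w = (if w = v then 2 else 0)"
      by (rule circuit_int_flow[OF C'(1)]) (use C' unbal in auto)
    obtain q where q: "\<And>e. e \<in> set ds \<Longrightarrow> q e = -1 \<or> q e = 1" "\<And>e. e \<notin> set ds \<Longrightarrow> q e = 0"
      "\<And>w. boundary q w = (if w = v then 2 else 0)"
      by (rule circuit_int_flow[OF D'(1)]) (use D' D(2) in auto)
    \<comment> \<open>Both circuits now start at \<open>v\<close>, so their surpluses of 2 cancel;
      edge-disjointness keeps the values of the difference in -1, 0, 1.\<close>
    have "int_flow (\<lambda>e. p e - q e)"
      by (simp add: int_flow_def boundary_diff p(3) q(3))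
    moreover have pq: "\<bar>p e - q e\<bar> \<le> 1 \<and> (odd (p e - q e) \<longleftrightarrow> e \<in> set es \<union> set ds)" for e
      using p(1,2)[of e] q(1,2)[of e] D_C(1)[of e]
      by (cases "e \<in> set es"; cases "e \<in> set ds") auto
    moreover have "odd (s e)" if "odd (p e - q e)" for e
      using that pq C(2) D_odd by blast
    moreover have "odd (p a - q a)" using pq a(1) by blast
    ultimately show ?thesis using a(2) by (intro exI[of _ "\<lambda>e. p e - q e"]) blast
  qed
qed

text \<open>With \<open>g\<close> obtained for \<open>s + h\<close>, the sum \<open>g + h\<close>
  has the parity of \<open>s\<close>. It stays bounded by 1: where \<open>h\<close> is odd,
  \<open>g\<close> is even and hence 0, and elsewhere \<open>h\<close> is 0.\<close>

lemma exists_parity_flow: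
  assumes no_barbell: "\<nexists>W F. long_barbell G W F"
    and s: "int_flow s"
  shows "\<exists>h. int_flow h \<and> (\<forall>e\<in>edges G. \<bar>h e\<bar> \<le> 1 \<and> (odd (h e) \<longleftrightarrow> odd (s e)))"
  using s
proof (induction "card {e \<in> edges G. odd (s e)}" arbitrary: s rule: less_induct)
  case less
  show ?case
  proof (cases "\<exists>e\<in>edges G. odd (s e)")
    case True
    then obtain h a where h: "int_flow h" "\<And>e. \<bar>h e\<bar> \<le> 1" "\<And>e. odd (h e) \<Longrightarrow> odd (s e)"
      and a: "a \<in> edges G" "odd (h a)"
      using exists_elementary_flow[OF no_barbell less.prems] by blast
    have "a \<in> {e \<in> edges G. odd (s e)} - {e \<in> edges G. odd (s e + h e)}"
      using a h(3) by auto
    moreover have "{e \<in> edges G. odd (s e + h e)} \<subseteq> {e \<in> edges G. odd (s e)}"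
      using h(3) by auto
    ultimately have "{e \<in> edges G. odd (s e + h e)} \<subset> {e \<in> edges G. odd (s e)}" by blast
    then have "card {e \<in> edges G. odd (s e + h e)} < card {e \<in> edges G. odd (s e)}"
      by (intro psubset_card_mono) auto
    moreover have "int_flow (\<lambda>e. s e + h e)"
      using less.prems h(1) by (simp add: int_flow_def boundary_add)
    ultimately obtain g where g: "int_flow g"
        "\<And>e. e \<in> edges G \<Longrightarrow> \<bar>g e\<bar> \<le> 1 \<and> (odd (g e) \<longleftrightarrow> odd (s e + h e))"
      using less.hyps[of "\<lambda>e. s e + h e"] by blast
    have "\<bar>g e + h e\<bar> \<le> 1 \<and> (odd (g e + h e) \<longleftrightarrow> odd (s e))" if "e \<in> edges G" for e
    proof (cases "odd (h e)")
      case True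
      then have "even (g e)" using g(2)[OF that] h(3)[of e] by auto
      then have "g e = 0" using g(2)[OF that] by presburger
      then show ?thesis using True h(2,3)[of e] by auto
    next
      case False
      then have "h e = 0" using h(2)[of e] by presburger
      then show ?thesis using g(2)[OF that] by auto
    qed
    moreover have "int_flow (\<lambda>e. g e + h e)"
      using g(1) h(1) by (simp add: int_flow_def boundary_add)
    ultimately show ?thesis by (intro exI[of _ "\<lambda>e. g e + h e"]) blast
  next
    case False
    then show ?thesis
      by (intro exI[of _ "\<lambda>_. 0"]) (auto simp: int_flow_def boundary_def)
  qed
qed

section \<open>Halving and decomposition\<close>

lemma boundary_cong: "(\<And>e. e \<in> edges G \<Longrightarrow> s e = t e) \<Longrightarrow> boundary s v = boundary t v"
  unfolding boundary_def by (intro sum.cong) (auto simp: half_edges_at_def)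

text \<open>The parts are \<open>(s + h) / 2\<close> and \<open>(s - h) / 2\<close>, which differ by
  \<open>h\<close>. Their doubles are at least -1, so by integrality they are non-negative.\<close>

lemma halve_flow:
  assumes no_barbell: "\<nexists>W F. long_barbell G W F"
    and s: "int_flow s" "\<And>e. e \<in> edges G \<Longrightarrow> 0 \<le> s e"
  obtains p q where "int_flow p" "int_flow q"
    "\<And>e. e \<in> edges G \<Longrightarrow> 0 \<le> p e \<and> 0 \<le> q e \<and> p e + q e = s e \<and> \<bar>p e - q e\<bar> \<le> 1"
proof -
  obtain h where h: "int_flow h" "\<And>e. e \<in> edges G \<Longrightarrow> \<bar>h e\<bar> \<le> 1 \<and> (odd (h e) \<longleftrightarrow> odd (s e))"
    using exists_parity_flow[OF no_barbell s(1)] by blast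
  \<comment> \<open>The values 1 and -1 of \<open>c\<close> give the two parts; on the edges the
    division is exact since \<open>s\<close> and \<open>h\<close> have equal parity.\<close>
  have half: "int_flow (\<lambda>e. (s e + c * h e) div 2)" if "odd c" for c
    unfolding int_flow_def
  proof
    fix v assume v: "v \<in> verts G"
    have "2 * boundary (\<lambda>e. (s e + c * h e) div 2) v = boundary (\<lambda>e. 2 * ((s e + c * h e) div 2)) v"
      by (simp only: boundary_scale)
    also have "\<dots> = boundary (\<lambda>e. s e + c * h e) v"
    proof (rule boundary_cong)
      fix e assume "e \<in> edges G"
      then have "even (s e + c * h e)" using h(2) that by simp
      then show "2 * ((s e + c * h e) div 2) = s e + c * h e" by simp
    qed
    also have "\<dots> = 0"
      using s(1) h(1) v by (simp add: boundary_add boundary_scale int_flow_def)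
    finally show "boundary (\<lambda>e. (s e + c * h e) div 2) v = 0" by simp
  qed
  show thesis
  proof
    show "int_flow (\<lambda>e. (s e + 1 * h e) div 2)" "int_flow (\<lambda>e. (s e + (-1) * h e) div 2)"
      by (rule half; simp)+
    fix e assume e: "e \<in> edges G"
    have "even (s e + h e)" using h(2)[OF e] by simp
    then obtain m where m: "s e + h e = 2 * m" by (rule evenE)
    then have "s e - h e = 2 * (m - h e)" by simp
    then have div: "(s e + 1 * h e) div 2 = m" "(s e + (-1) * h e) div 2 = m - h e"
      using m by simp_all
    have "0 \<le> s e" "- 1 \<le> h e" "h e \<le> 1" using s(2)[OF e] h(2)[OF e] by auto
    then show "0 \<le> (s e + 1 * h e) div 2 \<and> 0 \<le> (s e + (-1) * h e) div 2 \<and>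
        (s e + 1 * h e) div 2 + (s e + (-1) * h e) div 2 = s e \<and>
        \<bar>(s e + 1 * h e) div 2 - (s e + (-1) * h e) div 2\<bar> \<le> 1"
      unfolding div using m by arith
  qed
qed

text \<open>Among all families of non-negative flows with sum \<open>s\<close>, one with the least sum of squares
  takes values in \<open>{0, 1}\<close>: otherwise halving the sum of two members that differ by at
  least 2 on some edge would make it smaller.\<close>

lemma decompose_flow:
  fixes I :: "'i set"
  assumes no_barbell: "\<nexists>W F. long_barbell G W F"
    and s: "int_flow s" "\<And>e. e \<in> edges G \<Longrightarrow> 0 \<le> s e \<and> s e \<le> int (card I)"
    and I: "finite I" "I \<noteq> {}"
  shows "\<exists>fs. (\<forall>i\<in>I. int_flow (fs i) \<and> (\<forall>e\<in>edges G. 0 \<le> fs i e \<and> fs i e \<le> 1)) \<and>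
    (\<forall>e\<in>edges G. s e = (\<Sum>i\<in>I. fs i e))"
proof -
  define Fam where "Fam fs \<longleftrightarrow> (\<forall>i\<in>I. int_flow (fs i) \<and> (\<forall>e\<in>edges G. 0 \<le> fs i e)) \<and>
    (\<forall>e\<in>edges G. s e = (\<Sum>i\<in>I. fs i e))" for fs :: "'i \<Rightarrow> 'e \<Rightarrow> int"
  define sq where "sq fs = (\<Sum>e\<in>edges G. \<Sum>i\<in>I. (fs i e)\<^sup>2)" for fs :: "'i \<Rightarrow> 'e \<Rightarrow> int"
  \<comment> \<open>The initial family puts all of \<open>s\<close> on a single index.\<close>
  obtain i0 where "i0 \<in> I" using I(2) by blast
  moreover have "int_flow (\<lambda>e. if i = i0 then s e else 0)" for i
    using s(1) by (cases "i = i0") (simp_all add: int_flow_def boundary_def)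
  ultimately have "Fam (\<lambda>i e. if i = i0 then s e else 0)"
    using s(2) I(1) by (auto simp: Fam_def)
  then obtain fs where fs: "Fam fs" "\<And>gs. Fam gs \<Longrightarrow> nat (sq fs) \<le> nat (sq gs)"
    using ex_has_least_nat[of Fam _ "\<lambda>fs. nat (sq fs)"] by blast
  have "fs i a \<le> 1" if i: "i \<in> I" and a: "a \<in> edges G" for i a
  proof (rule ccontr)
    assume big: "\<not> fs i a \<le> 1"
    \<comment> \<open>Otherwise \<open>fs i a\<close>, being at least 2, would push the sum at
      \<open>a\<close> above \<open>card I\<close>.\<close>
    have "\<exists>j\<in>I - {i}. fs j a < 1"
    proof (rule ccontr)
      assume "\<not> ?thesis"
      then have "(\<Sum>j\<in>I - {i}. 1) \<le> (\<Sum>j\<in>I - {i}. fs j a)" by (intro sum_mono) force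
      moreover have "s a = fs i a + (\<Sum>j\<in>I - {i}. fs j a)"
        using fs(1) a I(1) i by (simp add: Fam_def sum.remove)
      moreover have "card I = Suc (card (I - {i}))" using I(1) i by (rule card.remove)
      ultimately show False using s(2)[OF a] big by simp
    qed
    then obtain j where j: "j \<in> I" "j \<noteq> i" "fs j a < 1" by blast
    define J where "J = I - {i, j}"
    have J: "I = insert i (insert j J)" "finite J" "i \<notin> insert j J" "j \<notin> J"
      using i j I(1) by (auto simp: J_def)
    have "int_flow (\<lambda>e. fs i e + fs j e)"
      using fs(1) i j by (simp add: Fam_def int_flow_def boundary_add)
    moreover have "0 \<le> fs i e + fs j e" if "e \<in> edges G" for e
      using fs(1) i j that by (simp add: Fam_def)
    ultimately obtain p q where pq: "int_flow p" "int_flow q"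
      "\<And>e. e \<in> edges G \<Longrightarrow> 0 \<le> p e \<and> 0 \<le> q e \<and> p e + q e = fs i e + fs j e \<and> \<bar>p e - q e\<bar> \<le> 1"
      using halve_flow[OF no_barbell, of "\<lambda>e. fs i e + fs j e"] by blast
    define gs where "gs = fs(i := p, j := q)"
    have gs: "gs i = p" "gs j = q" "\<And>k. k \<in> J \<Longrightarrow> gs k = fs k"
      using j J by (auto simp: gs_def)
    have "Fam gs"
      unfolding Fam_def
    proof (intro conjI ballI)
      fix k assume "k \<in> I"
      then show "int_flow (gs k)" "\<And>e. e \<in> edges G \<Longrightarrow> 0 \<le> gs k e"
        using pq fs(1) by (auto simp: gs_def Fam_def)
    next
      fix e assume e: "e \<in> edges G"
      have "s e = fs i e + (fs j e + (\<Sum>k\<in>J. fs k e))"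
        using fs(1) e J by (simp add: Fam_def)
      also have "\<dots> = p e + (q e + (\<Sum>k\<in>J. gs k e))"
        using pq(3)[OF e] gs(3) by simp
      also have "\<dots> = (\<Sum>k\<in>I. gs k e)" using J gs(1,2) by simp
      finally show "s e = (\<Sum>k\<in>I. gs k e)" .
    qed
    moreover have "sq gs < sq fs"
    proof -
      have diff: "(\<Sum>k\<in>I. (fs k e)\<^sup>2) - (\<Sum>k\<in>I. (gs k e)\<^sup>2) = (fs i e)\<^sup>2 + (fs j e)\<^sup>2 - (p e)\<^sup>2 - (q e)\<^sup>2"
        for e using J gs by simp
      \<comment> \<open>For a fixed sum \<open>x + y\<close>, twice the sum of squares is a constant
        plus the squared difference.\<close>
      have twice: "2 * ((fs i e)\<^sup>2 + (fs j e)\<^sup>2 - (p e)\<^sup>2 - (q e)\<^sup>2) = (fs i e - fs j e)\<^sup>2 - (p e - q e)\<^sup>2"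
        if "e \<in> edges G" for e
      proof -
        have q: "q e = fs i e + fs j e - p e" using pq(3)[OF that] by simp
        show ?thesis unfolding q by (simp add: power2_eq_square algebra_simps)
      qed
      have "(\<Sum>k\<in>I. (gs k e)\<^sup>2) \<le> (\<Sum>k\<in>I. (fs k e)\<^sup>2)" if e: "e \<in> edges G" for e
      proof -
        \<comment> \<open>Equal sums make the two differences congruent modulo 2, and the left one
          is at most 1 in absolute value.\<close>
        have "\<bar>p e - q e\<bar> \<le> \<bar>fs i e - fs j e\<bar>" using pq(3)[OF e] by presburger
        then have "(p e - q e)\<^sup>2 \<le> (fs i e - fs j e)\<^sup>2" by (rule abs_le_square_iff[THEN iffD1])
        then show ?thesis using diff[of e] twice[OF e] by simp
      qed
      moreover have "(\<Sum>k\<in>I. (gs k a)\<^sup>2) < (\<Sum>k\<in>I. (fs k a)\<^sup>2)"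
      proof -
        have "\<bar>p a - q a\<bar> < \<bar>fs i a - fs j a\<bar>" using pq(3)[OF a] big j(3) by presburger
        then have "(p a - q a)\<^sup>2 < (fs i a - fs j a)\<^sup>2"
          by (metis abs_ge_zero power2_abs power_strict_mono zero_less_numeral)
        then show ?thesis using diff[of a] twice[OF a] by simp
      qed
      ultimately show ?thesis unfolding sq_def using a by (intro sum_strict_mono_ex1) auto
    qed
    moreover have "0 \<le> sq gs" by (simp add: sq_def sum_nonneg)
    ultimately show False using fs(2)[of gs] by simp
  qed
  then show ?thesis using fs(1) unfolding Fam_def by blast
qed

section \<open>Transfer to real-valued flows\<close>

lemma flow_iff_int_flow: "flow G \<tau> (\<lambda>e. real_of_int (s e)) \<longleftrightarrow> int_flow s"
proof -
  have "(\<Sum>h\<in>half_edges_at G v. real_of_int (\<tau> h) * real_of_int (s (fst h))) =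
      real_of_int (boundary s v)" for v
    by (simp add: boundary_def)
  then show ?thesis using orientation by (simp add: flow_def int_flow_def)
qed

end

theorem theorem4p3:
  fixes G :: "('v, 'e) sgraph" and \<tau> :: "'e \<times> bool \<Rightarrow> int" and f :: "'e \<Rightarrow> real" and k :: nat
  assumes "signed_graph G"
    and "\<nexists>W F. long_barbell G W F"
    and "k \<ge> 2"
    and "nonneg_k_flow G k \<tau> f"
  shows "\<exists>fs :: nat \<Rightarrow> 'e \<Rightarrow> real.
           (\<forall>i\<in>{1..k - 1}. nonneg_k_flow G 2 \<tau> (fs i)) \<and>
           (\<forall>e\<in>edges G. f e = (\<Sum>i=1..k - 1. fs i e))"
proof -
  interpret oriented_signed_graph G \<tau>
    by standard (use assms in \<open>auto simp: nonneg_k_flow_def k_flow_def flow_def\<close>)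
  \<comment> \<open>On the edges \<open>f\<close> is integral, so the floor changes nothing
    there.\<close>
  define s where "s e = \<lfloor>f e\<rfloor>" for e
  have f: "f e = real_of_int (s e)" "0 \<le> f e" "f e \<le> real k - 1" if "e \<in> edges G" for e
    using assms(4) that by (auto simp: nonneg_k_flow_def k_flow_def s_def abs_le_iff)
  have "flow G \<tau> f" using assms(4) by (simp add: nonneg_k_flow_def k_flow_def)
  moreover have "(\<Sum>h\<in>half_edges_at G v. real_of_int (\<tau> h) * f (fst h)) =
      (\<Sum>h\<in>half_edges_at G v. real_of_int (\<tau> h) * real_of_int (s (fst h)))" for v
    using f(1) by (intro sum.cong) (auto simp: half_edges_at_def)
  ultimately have "flow G \<tau> (\<lambda>e. real_of_int (s e))" by (simp add: flow_def)
  then have "int_flow s" by (simp only: flow_iff_int_flow)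
  \<comment> \<open>The bound \<open>k - 1\<close> of a \<open>k\<close>-flow is exactly the number
    of available indices.\<close>
  moreover have "0 \<le> s e \<and> s e \<le> int (card {1..k - 1})" if "e \<in> edges G" for e
    using f[OF that] assms(3) by simp
  moreover have "{1..k - 1} \<noteq> {}" using assms(3) by simp
  ultimately obtain fs where fs: "\<And>i. i \<in> {1..k - 1} \<Longrightarrow> int_flow (fs i)"
      "\<And>i e. i \<in> {1..k - 1} \<Longrightarrow> e \<in> edges G \<Longrightarrow> 0 \<le> fs i e \<and> fs i e \<le> 1"
      "\<And>e. e \<in> edges G \<Longrightarrow> s e = (\<Sum>i=1..k - 1. fs i e)"
    using decompose_flow[OF assms(2), of s "{1..k - 1}"] by blast
  have "nonneg_k_flow G 2 \<tau> (\<lambda>e. real_of_int (fs i e))" if "i \<in> {1..k - 1}" for i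
    using fs(1,2)[OF that] by (auto simp: nonneg_k_flow_def k_flow_def flow_iff_int_flow)
  moreover have "f e = (\<Sum>i=1..k - 1. real_of_int (fs i e))" if "e \<in> edges G" for e
    using f(1)[OF that] fs(3)[OF that] by simp
  ultimately show ?thesis
    by (intro exI[of _ "\<lambda>i e. real_of_int (fs i e)"]) blast
qed

end
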